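(* Let $T>0$ and let $B=\{B_{t},\,t\in[0,T]\}$ be a fractional Brownian motion with Hurst index $H\in(0,1)$. Then, denoting $c_{H}=H+1/2$, we have for any $z>0$: $$P\left(\int_{0}^{T}B_{u}^{2}\,du\geq z+\frac{T^{2H+1}}{2c_{H}}\right)\leq\exp\left(-\frac{c_{H}^{2}\,z^{2}}{2c_{H}T^{2H+1}z+T^{4H+2}}\right).$$
   Context: A fractional Brownian motion with Hurst index $H\in(0,1)$ on $[0,T]$ is a centered Gaussian process $B=(B_t)_{t\in[0,T]}$ with continuous paths and covariance $E(B_tB_s)=\frac12\big(t^{2H}+s^{2H}-|t-s|^{2H}\big)$. *)

theory Defs
  imports "HOL-Probability.Probability"
begin

context prob_space
begin

text \<open>Degenerate (almost surely constant) variables count as Gaussian; fractional Brownian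
  motion needs this at time 0.\<close>

definition gaussian_rv :: "('a \<Rightarrow> real) \<Rightarrow> bool" where
  "gaussian_rv X \<longleftrightarrow> random_variable borel X \<and>
     ((\<exists>\<mu>. AE \<omega> in M. X \<omega> = \<mu>) \<or>
      (\<exists>\<mu> \<sigma>. 0 < \<sigma> \<and> distributed M lborel X (normal_density \<mu> \<sigma>)))"

definition gaussian_process_on :: "'t set \<Rightarrow> ('t \<Rightarrow> 'a \<Rightarrow> real) \<Rightarrow> bool" where
  "gaussian_process_on I X \<longleftrightarrow>
     (\<forall>J a. finite J \<longrightarrow> J \<subseteq> I \<longrightarrow> gaussian_rv (\<lambda>\<omega>. \<Sum>t\<in>J. a t * X t \<omega>))"

text \<open>Only the times in \<open>{0..T}\<close> matter: \<open>B t\<close> is unconstrained for other \<open>t\<close>.\<close>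

definition fractional_brownian_motion :: "real \<Rightarrow> real \<Rightarrow> (real \<Rightarrow> 'a \<Rightarrow> real) \<Rightarrow> bool" where
  "fractional_brownian_motion H T B \<longleftrightarrow>
     gaussian_process_on {0..T} B \<and>
     (\<forall>t\<in>{0..T}. expectation (B t) = 0) \<and>
     (\<forall>\<omega>\<in>space M. continuous_on {0..T} (\<lambda>t. B t \<omega>)) \<and>
     (\<forall>t\<in>{0..T}. \<forall>s\<in>{0..T}. expectation (\<lambda>\<omega>. B t \<omega> * B s \<omega>) =
        1 / 2 * (t powr (2 * H) + s powr (2 * H) - \<bar>t - s\<bar> powr (2 * H)))"

end

end

theory Submission
  imports Defs
begin

text \<open>
  Put \<open>\<sigma> u = u\<^sup>H\<close>, the standard deviation of \<open>B u\<close>, and \<open>m = \<integral> (\<sigma> u)\<^sup>2 du = T\<^sup>2\<^sup>H\<^sup>+\<^sup>1 / (2 c)\<close>.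
  No spectral decomposition of the Gaussian quadratic functional is needed: with respect to the
  probability density \<open>(\<sigma> u)\<^sup>2 / m\<close> on \<open>(0, T]\<close>, the functional is the mean of
  \<open>m (B u / \<sigma> u)\<^sup>2\<close>, so Jensen's inequality and Tonelli's theorem bound its exponential
  moment of order \<open>\<theta>\<close> by that of \<open>m \<xi>\<^sup>2\<close> with \<open>\<xi>\<close> standard normal, i.e. by
  \<open>(1 - 2 \<theta> m)\<^sup>-\<^sup>1\<^sup>/\<^sup>2\<close>. Chernoff's bound with the optimal \<open>\<theta> = z / (2 m (m + z))\<close> gives
  \<open>exp (- (x - ln (1 + x)) / 2)\<close> for \<open>x = z / m\<close>, and \<open>x - ln (1 + x) \<ge> x\<^sup>2 / (2 (1 + x))\<close>.
\<close>

text \<open>The difference of the two sides vanishes at 0, and with \<open>a = 1 / (1 + y)\<close>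
  its derivative is the perfect square \<open>(1 - a)\<^sup>2 / 2\<close>, hence
  nonnegative.\<close>

lemma ln_add_one_upper_bound:
  fixes x :: real
  assumes "0 \<le> x"
  shows "ln (1 + x) \<le> x - x\<^sup>2 / (2 * (1 + x))"
proof -
  have eq: "y - y\<^sup>2 / (2 * (1 + y)) = (y + 1 - 1 / (1 + y)) / 2" if "0 \<le> y" for y :: real
    using that by (simp add: field_simps power2_eq_square)
  define f where "f = (\<lambda>y::real. (y + 1 - 1 / (1 + y)) / 2 - ln (1 + y))"
  have "f 0 \<le> f x"
  proof (rule DERIV_nonneg_imp_nondecreasing[OF assms])
    fix y :: real assume y: "0 \<le> y" "y \<le> x"
    have "(1 + a * a) / 2 - a = (1 - a)\<^sup>2 / 2" for a :: real
      by (simp add: power2_eq_square field_simps)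
    from this[of "1 / (1 + y)"] have "(f has_real_derivative ((1 - 1 / (1 + y))\<^sup>2 / 2)) (at y)"
      unfolding f_def using y by (auto intro!: derivative_eq_intros simp: add_divide_distrib)
    then show "\<exists>d. (f has_real_derivative d) (at y) \<and> 0 \<le> d"
      by (intro exI conjI) auto
  qed
  then show ?thesis unfolding eq[OF assms] by (simp add: f_def)
qed

text \<open>Rounding the time down to the grid of mesh 1/(n+1) leaves countably many times, so each
  rounded process is jointly measurable. By path continuity these processes converge pointwise to
  Y.\<close>

lemma borel_measurable_Caratheodory:
  fixes Y :: "real \<Rightarrow> 'a \<Rightarrow> real"
  assumes meas: "\<And>u. Y u \<in> borel_measurable M"
    and cont: "\<And>\<omega>. \<omega> \<in> space M \<Longrightarrow> continuous_on UNIV (\<lambda>u. Y u \<omega>)"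
  shows "(\<lambda>(u, \<omega>). Y u \<omega>) \<in> borel_measurable (borel \<Otimes>\<^sub>M M)"
proof (rule borel_measurable_LIMSEQ_real)
  let ?q = "\<lambda>n (u::real). real_of_int \<lfloor>real (Suc n) * u\<rfloor> / real (Suc n)"
  show "(\<lambda>p. Y (?q n (fst p)) (snd p)) \<in> borel_measurable (borel \<Otimes>\<^sub>M M)" for n
  proof (rule measurable_compose_countable[where f = "\<lambda>k p. Y (real_of_int k / real (Suc n)) (snd p)"])
    show "(\<lambda>p. Y (real_of_int k / real (Suc n)) (snd p)) \<in> borel_measurable (borel \<Otimes>\<^sub>M M)" for k
      using meas by (rule measurable_compose[OF measurable_snd])
    show "(\<lambda>p. \<lfloor>real (Suc n) * fst p\<rfloor>) \<in> (borel :: real measure) \<Otimes>\<^sub>M M \<rightarrow>\<^sub>M count_space UNIV"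
      by measurable
  qed
  fix p :: "real \<times> 'a" assume "p \<in> space (borel \<Otimes>\<^sub>M M)"
  then have \<omega>: "snd p \<in> space M" by (auto simp: space_pair_measure)
  have "(\<lambda>n. ?q n (fst p)) \<longlonglongrightarrow> fst p"
  proof (rule tendsto_sandwich[OF _ _ _ tendsto_const])
    have low: "fst p - 1 / real (Suc n) \<le> ?q n (fst p)" for n
    proof -
      have "real (Suc n) * fst p - 1 \<le> real_of_int \<lfloor>real (Suc n) * fst p\<rfloor>" by linarith
      then have "(real (Suc n) * fst p - 1) / real (Suc n) \<le> ?q n (fst p)"
        by (intro divide_right_mono) auto
      then show ?thesis by (simp add: diff_divide_distrib)
    qed
    then show "\<forall>\<^sub>F n in sequentially. fst p - 1 / real (Suc n) \<le> ?q n (fst p)"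
      by simp
    have "?q n (fst p) \<le> fst p" for n
      using of_int_floor_le[of "real (Suc n) * fst p"]
      by (simp only: pos_divide_le_eq of_nat_0_less_iff zero_less_Suc mult.commute)
    then show "\<forall>\<^sub>F n in sequentially. ?q n (fst p) \<le> fst p"
      by simp
    show "(\<lambda>n. fst p - 1 / real (Suc n)) \<longlonglongrightarrow> fst p"
      using tendsto_diff[OF tendsto_const LIMSEQ_inverse_real_of_nat, of "fst p"]
      by (simp add: inverse_eq_divide)
  qed
  then have "(\<lambda>n. Y (?q n (fst p)) (snd p)) \<longlonglongrightarrow> Y (fst p) (snd p)"
    using cont[OF \<omega>] by (intro isCont_tendsto_compose[of _ "\<lambda>u. Y u (snd p)"])
      (auto simp: continuous_on_eq_continuous_at)
  then show "(\<lambda>n. Y (?q n (fst p)) (snd p)) \<longlonglongrightarrow> (case p of (u, \<omega>) \<Rightarrow> Y u \<omega>)"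
    by (simp add: case_prod_beta)
qed

text \<open>Jensen's inequality for the convex exponential. The right side is a nonnegative
  integral, so it is infinite, and the bound trivial, when exp f is not integrable.\<close>

lemma (in prob_space) exp_expectation_le_nn_integral:
  fixes f :: "'a \<Rightarrow> real"
  assumes f: "integrable M f"
  shows "ennreal (exp (expectation f)) \<le> (\<integral>\<^sup>+x. ennreal (exp (f x)) \<partial>M)"
proof (cases "integrable M (\<lambda>x. exp (f x))")
  case True
  have "exp (expectation f) \<le> expectation (\<lambda>x. exp (f x))"
    using jensens_inequality[OF f _ _ True, of UNIV] by (auto simp: exp_convex)
  also have "ennreal \<dots> = (\<integral>\<^sup>+x. ennreal (exp (f x)) \<partial>M)"
    using True by (simp add: nn_integral_eq_integral)
  finally show ?thesis by (simp add: ennreal_leI)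
next
  case False
  then have "(\<integral>\<^sup>+x. ennreal (exp (f x)) \<partial>M) = \<infinity>"
    using f by (auto simp: integrable_iff_bounded less_top[symmetric])
  then show ?thesis by simp
qed

text \<open>With \<open>d = 1 - 2 * a * \<sigma>\<^sup>2\<close>, the factor exp(a x^2) turns the
  centered normal density of deviation \<sigma> into 1/sqrt d times the one of deviation
  \<sigma>/sqrt d, whose total mass is 1.\<close>

lemma (in prob_space) nn_integral_exp_square_normal:
  assumes D: "distributed M lborel X (normal_density 0 \<sigma>)" and \<sigma>: "0 < \<sigma>"
    and a: "2 * a * \<sigma>\<^sup>2 < 1"
  shows "(\<integral>\<^sup>+\<omega>. ennreal (exp (a * (X \<omega>)\<^sup>2)) \<partial>M) = ennreal (1 / sqrt (1 - 2 * a * \<sigma>\<^sup>2))"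
proof -
  define d where "d = 1 - 2 * a * \<sigma>\<^sup>2"
  have d: "0 < d" using a by (simp add: d_def)
  have eq: "normal_density 0 \<sigma> x * exp (a * x\<^sup>2) = 1 / sqrt d * normal_density 0 (\<sigma> / sqrt d) x" for x
  proof -
    have "a * x\<^sup>2 + - x\<^sup>2 / (2 * \<sigma>\<^sup>2) = - x\<^sup>2 / (2 * (\<sigma> / sqrt d)\<^sup>2)"
      using \<sigma> d by (simp add: d_def power_divide field_simps)
    moreover have "1 / sqrt (2 * pi * \<sigma>\<^sup>2) = 1 / sqrt d * (1 / sqrt (2 * pi * (\<sigma> / sqrt d)\<^sup>2))"
      using \<sigma> d by (simp add: power_divide real_sqrt_mult real_sqrt_divide)
    ultimately show ?thesis
      unfolding normal_density_def by (simp flip: exp_add add: ac_simps)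
  qed
  have "(\<integral>\<^sup>+\<omega>. ennreal (exp (a * (X \<omega>)\<^sup>2)) \<partial>M)
      = (\<integral>\<^sup>+x. ennreal (normal_density 0 \<sigma> x) * ennreal (exp (a * x\<^sup>2)) \<partial>lborel)"
    by (subst distributed_nn_integral[OF D, symmetric]) auto
  also have "\<dots> = (\<integral>\<^sup>+x. ennreal (1 / sqrt d) * ennreal (normal_density 0 (\<sigma> / sqrt d) x) \<partial>lborel)"
    by (intro nn_integral_cong) (use d in \<open>simp flip: ennreal_mult add: eq\<close>)
  also have "\<dots> = ennreal (1 / sqrt d) * (\<integral>\<^sup>+x. ennreal (normal_density 0 (\<sigma> / sqrt d) x) \<partial>lborel)"
    by (rule nn_integral_cmult) auto
  also have "(\<integral>\<^sup>+x. ennreal (normal_density 0 (\<sigma> / sqrt d) x) \<partial>lborel) = 1"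
    using \<sigma> d by (subst nn_integral_eq_integral) auto
  finally show ?thesis by (simp add: d_def)
qed

text \<open>An almost surely constant variable of mean 0 has second moment 0, which contradicts
  \<open>0 < s\<close>. This leaves the case with a density, where mean and variance determine the
  parameters.\<close>

lemma (in prob_space) gaussian_rv_centered_distributed:
  assumes G: "gaussian_rv X" and mean: "expectation X = 0"
    and var: "expectation (\<lambda>\<omega>. (X \<omega>)\<^sup>2) = s\<^sup>2" and s: "0 < s"
  shows "distributed M lborel X (normal_density 0 s)"
proof -
  have X: "random_variable borel X" using G by (simp add: gaussian_rv_def)
  consider \<mu> where "AE \<omega> in M. X \<omega> = \<mu>"
    | \<mu> \<sigma> where "0 < \<sigma>" "distributed M lborel X (normal_density \<mu> \<sigma>)"
    using G by (auto simp: gaussian_rv_def)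
  then show ?thesis
  proof cases
    case 1
    have "expectation X = expectation (\<lambda>_. \<mu>)"
      using 1 X by (intro integral_cong_AE) auto
    then have "\<mu> = 0" using mean by (simp add: prob_space)
    then have "expectation (\<lambda>\<omega>. (X \<omega>)\<^sup>2) = expectation (\<lambda>_. 0)"
      using 1 X by (intro integral_cong_AE) auto
    then show ?thesis using var s by simp
  next
    case 2
    have "\<mu> = 0" using normal_distributed_expectation[OF 2] mean by simp
    moreover have "\<sigma>\<^sup>2 = s\<^sup>2"
      using normal_distributed_variance[OF 2] mean var by simp
    ultimately show ?thesis using 2 s by (simp add: power2_eq_iff_nonneg)
  qed
qed

text \<open>Jensen is applied to each path before the expectation is taken. After the two integrals
  are exchanged, each inner expectation concerns a single time u, so only the one-dimensional laws
  enter.\<close>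

lemma nn_integral_exp_integral_square_le:
  fixes B :: "real \<Rightarrow> 'a \<Rightarrow> real" and \<sigma> :: "real \<Rightarrow> real"
  assumes "prob_space M"
    and B[measurable]: "(\<lambda>(u, \<omega>). B u \<omega>) \<in> borel_measurable (borel \<Otimes>\<^sub>M M)"
    and \<sigma>[measurable]: "\<sigma> \<in> borel_measurable borel"
    and I[measurable]: "I \<in> sets borel"
    and pos: "\<And>u. u \<in> I \<Longrightarrow> 0 < \<sigma> u"
    and D: "\<And>u. u \<in> I \<Longrightarrow> distributed M lborel (B u) (normal_density 0 (\<sigma> u))"
    and int: "\<And>\<omega>. \<omega> \<in> space M \<Longrightarrow> set_integrable lborel I (\<lambda>u. (B u \<omega>)\<^sup>2)"
    and m: "set_integrable lborel I (\<lambda>u. (\<sigma> u)\<^sup>2)" "(LBINT u:I. (\<sigma> u)\<^sup>2) = m" "0 < m"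
    and \<theta>: "2 * \<theta> * m < 1"
  shows "(\<integral>\<^sup>+\<omega>. ennreal (exp (\<theta> * (LBINT u:I. (B u \<omega>)\<^sup>2))) \<partial>M) \<le> ennreal (1 / sqrt (1 - 2 * \<theta> * m))"
proof -
  interpret prob_space M by fact
  interpret pair_sigma_finite lborel M ..
  have [measurable]: "(\<lambda>p. B (fst p) (snd p)) \<in> borel_measurable (lborel \<Otimes>\<^sub>M M)"
    using B by (simp add: case_prod_beta' measurable_cong_sets[OF sets_pair_measure_cong[OF sets_lborel refl] refl])
  \<comment> \<open>The weights are chosen so that \<open>w u * f \<omega> u\<close> equals \<theta>
    times the integrand on I, while for u in I the law of \<open>f \<omega> u\<close> under M does
    not depend on u. Off I the weight is 0, whatever the quotient in f is there.\<close>
  define w where "w u = indicator I u * (\<sigma> u)\<^sup>2 / m" for u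
  define f where "f \<omega> u = \<theta> * m * (B u \<omega>)\<^sup>2 / (\<sigma> u)\<^sup>2" for \<omega> u
  define N where "N = density lborel (\<lambda>u. ennreal (w u))"
  have [measurable]: "w \<in> borel_measurable borel" unfolding w_def by measurable
  have w0: "0 \<le> w u" for u using m by (simp add: w_def)
  have w1: "(\<integral>\<^sup>+u. ennreal (w u) \<partial>lborel) = 1"
  proof -
    have "integrable lborel w" "integral\<^sup>L lborel w = 1"
      using m unfolding w_def set_integrable_def set_lebesgue_integral_def by auto
    then show ?thesis by (subst nn_integral_eq_integral) (auto simp: w0)
  qed
  interpret N: prob_space N
    by (intro prob_spaceI) (simp add: N_def emeasure_density w1)
  have jensen: "ennreal (exp (\<theta> * (LBINT u:I. (B u \<omega>)\<^sup>2)))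
      \<le> (\<integral>\<^sup>+u. ennreal (w u) * ennreal (exp (f \<omega> u)) \<partial>lborel)" if \<omega>: "\<omega> \<in> space M" for \<omega>
  proof -
    have [measurable]: "(\<lambda>u. B u \<omega>) \<in> borel_measurable borel"
      using measurable_compose[OF measurable_Pair2'[OF \<omega>] B] by simp
    have [measurable]: "f \<omega> \<in> borel_measurable borel" unfolding f_def by measurable
    have wf: "w u *\<^sub>R f \<omega> u = \<theta> * (indicator I u *\<^sub>R (B u \<omega>)\<^sup>2)" for u
      using m pos[of u] by (auto simp: w_def f_def split: split_indicator)
    have "integrable lborel (\<lambda>u. w u *\<^sub>R f \<omega> u)"
      unfolding wf using int[OF \<omega>] by (simp add: set_integrable_def)
    then have "integrable N (f \<omega>)"
      unfolding N_def by (subst integrable_density) (auto simp: w0)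
    moreover have "integral\<^sup>L N (f \<omega>) = \<theta> * (LBINT u:I. (B u \<omega>)\<^sup>2)"
      unfolding N_def by (subst integral_density) (simp_all only: wf, auto simp: w0 set_lebesgue_integral_def)
    moreover have "(\<integral>\<^sup>+u. ennreal (exp (f \<omega> u)) \<partial>N) = (\<integral>\<^sup>+u. ennreal (w u) * ennreal (exp (f \<omega> u)) \<partial>lborel)"
      unfolding N_def by (rule nn_integral_density) auto
    ultimately show ?thesis
      using N.exp_expectation_le_nn_integral[of "f \<omega>"] by simp
  qed
  have gauss: "(\<integral>\<^sup>+\<omega>. ennreal (w u) * ennreal (exp (f \<omega> u)) \<partial>M)
      = ennreal (w u) * ennreal (1 / sqrt (1 - 2 * \<theta> * m))" for u
  proof (cases "u \<in> I")
    case True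
    have [measurable]: "B u \<in> borel_measurable M"
      using D[OF True] by (simp add: distributed_def)
    \<comment> \<open>For the coefficient a = \<theta> m / \<sigma>(u)^2 the quantity 2 a
      \<sigma>(u)^2 is 2 \<theta> m, the same for all u.\<close>
    have "(\<integral>\<^sup>+\<omega>. ennreal (exp (f \<omega> u)) \<partial>M) = ennreal (1 / sqrt (1 - 2 * \<theta> * m))"
      using nn_integral_exp_square_normal[OF D[OF True] pos[OF True], of "\<theta> * m / (\<sigma> u)\<^sup>2"] pos[OF True] \<theta>
      by (simp add: f_def mult.assoc)
    then show ?thesis
      unfolding f_def by (subst nn_integral_cmult) auto
  qed (simp add: w_def)
  have "(\<integral>\<^sup>+\<omega>. ennreal (exp (\<theta> * (LBINT u:I. (B u \<omega>)\<^sup>2))) \<partial>M)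
      \<le> (\<integral>\<^sup>+\<omega>. \<integral>\<^sup>+u. ennreal (w u) * ennreal (exp (f \<omega> u)) \<partial>lborel \<partial>M)"
    by (intro nn_integral_mono jensen)
  also have "\<dots> = (\<integral>\<^sup>+u. \<integral>\<^sup>+\<omega>. ennreal (w u) * ennreal (exp (f \<omega> u)) \<partial>M \<partial>lborel)"
    unfolding f_def by (rule Fubini') measurable
  also have "\<dots> = ennreal (1 / sqrt (1 - 2 * \<theta> * m))"
    by (simp add: gauss nn_integral_multc w1)
  finally show ?thesis .
qed

theorem proposition1p3:
  fixes M :: "'a measure" and B :: "real \<Rightarrow> 'a \<Rightarrow> real" and H T c z :: real
  assumes "prob_space M"
    and "0 < T"
    and "0 < H" and "H < 1"
    and "prob_space.fractional_brownian_motion M H T B"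
    and "c = H + 1 / 2"
    and "0 < z"
  shows "\<P>(\<omega> in M. (LBINT u:{0..T}. (B u \<omega>)\<^sup>2) \<ge> z + T powr (2 * H + 1) / (2 * c))
    \<le> exp (- (c\<^sup>2 * z\<^sup>2 / (2 * c * T powr (2 * H + 1) * z + T powr (4 * H + 2))))"
proof -
  interpret prob_space M by fact
  have gp: "gaussian_process_on {0..T} B"
    and mean: "\<And>t. t \<in> {0..T} \<Longrightarrow> expectation (B t) = 0"
    and cont: "\<And>\<omega>. \<omega> \<in> space M \<Longrightarrow> continuous_on {0..T} (\<lambda>t. B t \<omega>)"
    and cov: "\<And>t s. t \<in> {0..T} \<Longrightarrow> s \<in> {0..T} \<Longrightarrow> expectation (\<lambda>\<omega>. B t \<omega> * B s \<omega>) =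
      1 / 2 * (t powr (2 * H) + s powr (2 * H) - \<bar>t - s\<bar> powr (2 * H))"
    using assms(5) unfolding fractional_brownian_motion_def by blast+
  define m where "m = T powr (2 * H + 1) / (2 * c)"
  \<comment> \<open>The exponent -\<theta>(z + m) - ln(1 - 2 \<theta> m)/2 is stationary where 1 - 2
    \<theta> m = m/(m + z), which is 1/(1 + x).\<close>
  define \<theta> where "\<theta> = z / (2 * m * (m + z))"
  define x where "x = z / m"
  \<comment> \<open>\<open>B\<close> is unconstrained off \<open>[0, T]\<close>; clamping the time makes the paths continuous on the whole line.\<close>
  define Y where "Y u = B (max 0 (min T u))" for u
  have c: "0 < c" using assms by simp
  have m: "0 < m" using assms c by (simp add: m_def)
  have x: "0 < x" using m assms by (simp add: x_def)
  have gauss: "gaussian_rv (B u)" if "u \<in> {0..T}" for u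
  proof -
    have "gaussian_rv (\<lambda>\<omega>. \<Sum>t\<in>{u}. 1 * B t \<omega>)"
      using gp that unfolding gaussian_process_on_def
      by (elim allE[of _ "{u}"] allE[of _ "\<lambda>_. 1"]) simp
    then show ?thesis by simp
  qed
  have YB: "Y u = B u" if "u \<in> {0..T}" for u using that by (simp add: Y_def)
  have Ymeas: "Y u \<in> borel_measurable M" for u
    using gauss[of "max 0 (min T u)"] assms by (simp add: Y_def gaussian_rv_def)
  have Ycont: "continuous_on UNIV (\<lambda>u. Y u \<omega>)" if "\<omega> \<in> space M" for \<omega>
    unfolding Y_def
    by (rule continuous_on_compose2[OF cont[OF that], of _ "\<lambda>u. max 0 (min T u)"])
      (use assms(2) in \<open>auto intro!: continuous_intros\<close>)
  note Y = borel_measurable_Caratheodory[OF Ymeas Ycont]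
  \<comment> \<open>Time 0 is left out because B has variance 0 there and hence no density; a single
    point does not change the integral.\<close>
  define S where "S \<omega> = (LBINT u:{0<..T}. (Y u \<omega>)\<^sup>2)" for \<omega>
  have Icc_Ioc: "(LBINT u:{0..T}. g u) = (LBINT u:{0<..T}. g u)" for g :: "real \<Rightarrow> real"
    using interval_integral_Icc[of 0 T g] interval_integral_Ioc[of 0 T g] assms(2) by simp
  have S: "(LBINT u:{0..T}. (B u \<omega>)\<^sup>2) = S \<omega>" for \<omega>
    unfolding Icc_Ioc unfolding S_def set_lebesgue_integral_def
    by (intro Bochner_Integration.integral_cong) (auto simp: YB split: split_indicator)
  have Dist: "distributed M lborel (Y u) (normal_density 0 (u powr H))" if "u \<in> {0<..T}" for u
  proof -
    have u: "u \<in> {0..T}" "0 < u" using that by auto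
    \<comment> \<open>On the diagonal the last covariance term is a power of 0, which
      \<open>powr\<close> evaluates to 0.\<close>
    have "expectation (\<lambda>\<omega>. B u \<omega> * B u \<omega>) = u powr (2 * H)"
      using cov[OF u(1) u(1)] by simp
    also have "\<dots> = (u powr H)\<^sup>2" using u by (simp add: power2_eq_square flip: powr_add)
    finally have "expectation (\<lambda>\<omega>. (B u \<omega>)\<^sup>2) = (u powr H)\<^sup>2" by (simp add: power2_eq_square)
    then show ?thesis
      unfolding YB[OF u(1)] using u
      by (intro gaussian_rv_centered_distributed gauss mean) auto
  qed
  have var: "set_integrable lborel {0<..T} (\<lambda>u. (u powr H)\<^sup>2)" "(LBINT u:{0<..T}. (u powr H)\<^sup>2) = m"
  proof -
    have sq: "(u powr H)\<^sup>2 = u powr (2 * H)" for u :: real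
      by (simp add: power2_eq_square flip: powr_add)
    have int: "set_integrable lborel {0..T} (\<lambda>u. u powr (2 * H))"
      using assms by (intro borel_integrable_atLeastAtMost' continuous_on_powr' continuous_intros) auto
    then show "set_integrable lborel {0<..T} (\<lambda>u. (u powr H)\<^sup>2)"
      unfolding sq by (rule set_integrable_subset) auto
    \<comment> \<open>The integral is T^(2H+1)/(2H+1), and 2c = 2H + 1.\<close>
    have "integral {0..T} (\<lambda>u. u powr (2 * H)) = m"
      using has_integral_powr_from_0[of "2 * H" T] assms
      by (auto simp: m_def algebra_simps dest!: integral_unique)
    then show "(LBINT u:{0<..T}. (u powr H)\<^sup>2) = m"
      using set_borel_integral_eq_integral(2)[OF int] by (simp add: sq flip: Icc_Ioc)
  qed
  have "2 * \<theta> * m = z / (m + z)" using m by (simp add: \<theta>_def)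
  then have \<theta>m: "1 - 2 * \<theta> * m = 1 / (1 + x)" "2 * \<theta> * m < 1"
    unfolding x_def using m assms(7) by (simp_all only:) (auto simp: field_simps)
  have \<theta>z: "\<theta> * (z + m) = x / 2"
    using m assms(7) by (simp add: \<theta>_def x_def add.commute[of z] nonzero_eq_divide_eq)
  have \<theta>: "0 < \<theta>" using m assms(7) by (simp add: \<theta>_def)
  have sqint: "set_integrable lborel {0<..T} (\<lambda>u. (Y u \<omega>)\<^sup>2)" if "\<omega> \<in> space M" for \<omega>
    by (rule set_integrable_subset[of _ "{0..T}"], intro borel_integrable_atLeastAtMost')
      (auto intro!: continuous_intros continuous_on_subset[OF Ycont[OF that]])
  have mgf: "(\<integral>\<^sup>+\<omega>. ennreal (exp (\<theta> * S \<omega>)) \<partial>M) \<le> ennreal (sqrt (1 + x))"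
    using nn_integral_exp_integral_square_le[OF assms(1) Y _ _ _ Dist sqint var m \<theta>m(2)]
    unfolding S_def \<theta>m(1) using x by (simp add: real_sqrt_divide)
  have [measurable]: "S \<in> borel_measurable M"
  proof -
    have [measurable]: "(\<lambda>p. Y (snd p) (fst p)) \<in> borel_measurable (M \<Otimes>\<^sub>M lborel)"
      using measurable_pair_swap[OF Y]
      by (simp add: case_prod_beta' measurable_cong_sets[OF sets_pair_measure_cong[OF refl sets_lborel] refl])
    show ?thesis unfolding S_def set_lebesgue_integral_def by measurable
  qed
  \<comment> \<open>Markov's inequality for exp(\<theta> S), which \<open>mgf\<close> then bounds by
    exp(-x/2) sqrt(1 + x).\<close>
  have "emeasure M {\<omega>\<in>space M. z + m \<le> S \<omega>}
      \<le> ennreal (exp (- \<theta> * (z + m))) * (\<integral>\<^sup>+\<omega>. ennreal (exp (\<theta> * S \<omega>)) * indicator (space M) \<omega> \<partial>M)"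
    using \<theta> by (intro Chernoff_ineq_nn_integral_ge) auto
  also have "(\<integral>\<^sup>+\<omega>. ennreal (exp (\<theta> * S \<omega>)) * indicator (space M) \<omega> \<partial>M)
      = (\<integral>\<^sup>+\<omega>. ennreal (exp (\<theta> * S \<omega>)) \<partial>M)"
    by (intro nn_integral_cong) auto
  also have "ennreal (exp (- \<theta> * (z + m))) * \<dots> \<le> ennreal (exp (- \<theta> * (z + m))) * ennreal (sqrt (1 + x))"
    using mgf by (rule mult_left_mono) simp
  finally have "prob {\<omega>\<in>space M. z + m \<le> S \<omega>} \<le> sqrt (1 + x) * exp (- (x / 2))"
    using x by (simp add: emeasure_eq_measure \<theta>z mult.commute flip: ennreal_mult)
  also have "sqrt (1 + x) = exp (ln (1 + x) / 2)"
    using x exp_ln[of "sqrt (1 + x)"] by (simp add: ln_sqrt)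
  also have "exp (ln (1 + x) / 2) * exp (- (x / 2)) \<le> exp (- (x\<^sup>2 / (4 * (1 + x))))"
    using ln_add_one_upper_bound[of x] x by (simp flip: exp_add add: field_simps)
  also have "x\<^sup>2 / (4 * (1 + x)) = c\<^sup>2 * z\<^sup>2 / (2 * c * T powr (2 * H + 1) * z + T powr (4 * H + 2))"
  proof -
    \<comment> \<open>Substituting T^(2H+1) = 2cm makes the denominator 4 c^2 m (z + m). The factor
      c^2 cancels, and z = m x gives the left side.\<close>
    have "T powr (2 * H + 1) = 2 * c * m" using c by (simp add: m_def)
    moreover have "T powr (4 * H + 2) = (T powr (2 * H + 1))\<^sup>2"
      by (simp add: power2_eq_square flip: powr_add)
    ultimately have "c\<^sup>2 * z\<^sup>2 / (2 * c * T powr (2 * H + 1) * z + T powr (4 * H + 2))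
        = c\<^sup>2 * z\<^sup>2 / (c\<^sup>2 * (4 * m * z + 4 * m\<^sup>2))"
      by (simp add: power2_eq_square algebra_simps)
    also have "\<dots> = z\<^sup>2 / (4 * m * z + 4 * m\<^sup>2)" using c by simp
    also have "\<dots> = x\<^sup>2 / (4 * (1 + x))"
      using m assms(7) by (simp add: x_def power2_eq_square field_simps)
    finally show ?thesis by simp
  qed
  finally show ?thesis unfolding S m_def .
qed

end
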